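(* Let $\mathcal{K}$ be a pointed closed convex cone in a finite-dimensional real inner product space $\mathcal{E}$. (i) If $\mathcal{K}$ is projectionally exposed, then $\mathcal{K}$ is amenable. In particular, if $\mathcal{F}$ is a face of $\mathcal{K}$ and $\mathcal{P}:\mathcal{E}\to\mathcal{E}$ is a projection with $\mathcal{P}(\mathcal{K})=\mathcal{F}$, then $\operatorname{dist}(x,\mathcal{F})\le \|\mathcal{P}\|\operatorname{dist}(x,\mathcal{K})$ for all $x\in\operatorname{span}\mathcal{F}$, where $\|\mathcal{P}\|$ is the operator norm of $\mathcal{P}$. (ii) If $\mathcal{K}$ is polyhedral, then $\mathcal{K}$ is amenable. (iii) If $\mathcal{K}$ is strictly convex, then $\mathcal{K}$ is amenable.
   Context: $\|x\|=\sqrt{\langle x,x\rangle}$ and $\operatorname{dist}(x,C)=\inf\{\|x-y\|: y\in C\}$. A convex cone is a nonempty set closed under nonnegative linear combinations; it is pointed if $\mathcal{K}\cap-\mathcal{K}=\{0\}$. A face of $\mathcal{K}$ is a convex cone $\mathcal{F}\subseteq\mathcal{K}$ such that $x,y\in\mathcal{K}$, $x+y\in\mathcal{F}$ imply $x,y\in\mathcal{F}$. A closed convex cone $\mathcal{K}$ is amenable if for every face $\mathcal{F}$ of $\mathcal{K}$ there is a constant $\kappa>0$ such that $\operatorname{dist}(x,\mathcal{F})\le\kappa\operatorname{dist}(x,\mathcal{K})$ for all $x\in\operatorname{span}\mathcal{F}$. A projection is a linear map $\mathcal{P}:\mathcal{E}\to\mathcal{E}$ with $\mathcal{P}^2=\mathcal{P}$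 (not necessarily orthogonal). $\mathcal{K}$ is projectionally exposed if for every face $\mathcal{F}$ of $\mathcal{K}$ there is a projection $\mathcal{P}$ with $\mathcal{P}(\mathcal{K})=\mathcal{F}$. $\mathcal{K}$ is polyhedral if it is the solution set of finitely many linear inequalities. A pointed cone $\mathcal{K}$ is strictly convex if its only faces besides $\mathcal{K}$ and $\{0\}$ are extreme rays (one-dimensional faces). *)

theory Defs
  imports "HOL-Analysis.Analysis"
begin

definition pointed_cone :: "'a::real_vector set \<Rightarrow> bool" where
  "pointed_cone K \<longleftrightarrow> K \<inter> uminus ` K = {0}"

(* Unlike face_of, this excludes the empty set: a face is itself a convex cone. *)
definition cone_face :: "'a::real_vector set \<Rightarrow> 'a set \<Rightarrow> bool" where
  "cone_face F K \<longleftrightarrow>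
     convex_cone F \<and> F \<subseteq> K \<and> (\<forall>x\<in>K. \<forall>y\<in>K. x + y \<in> F \<longrightarrow> x \<in> F \<and> y \<in> F)"

definition amenable :: "'a::real_inner set \<Rightarrow> bool" where
  "amenable K \<longleftrightarrow>
     closed K \<and> convex_cone K \<and>
     (\<forall>F. cone_face F K \<longrightarrow>
        (\<exists>\<kappa>>0. \<forall>x\<in>span F. infdist x F \<le> \<kappa> * infdist x K))"

(* Not necessarily orthogonal. *)
definition linear_projection :: "('a::real_vector \<Rightarrow> 'a) \<Rightarrow> bool" where
  "linear_projection P \<longleftrightarrow> linear P \<and> P \<circ> P = P"

definition projectionally_exposed :: "'a::real_vector set \<Rightarrow> bool" where
  "projectionally_exposed K \<longleftrightarrow>
     (\<forall>F. cone_face F K \<longrightarrow> (\<exists>P. linear_projection P \<and> P ` K = F))"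

definition strictly_convex_cone :: "'a::real_vector set \<Rightarrow> bool" where
  "strictly_convex_cone K \<longleftrightarrow>
     pointed_cone K \<and>
     (\<forall>F. cone_face F K \<longrightarrow> F = K \<or> F = {0} \<or> dim F = 1)"

end

theory Submission
  imports Defs
begin

text \<open>A projection \<open>P\<close> with \<open>P ` K = F\<close> fixes \<open>span F\<close>, so \<open>norm (x - P y) \<le> onorm P * norm (x - y)\<close>
  for \<open>x \<in> span F\<close> and \<open>y \<in> K\<close>, which gives (i). For (iii), the only nontrivial faces are rays, whose span
  adds the opposite ray, and this ray is at a linearly growing distance from \<open>K\<close> because \<open>K\<close> is closed and pointed.

  For (ii), a polyhedral cone is cut out by inequalities \<open>a \<bullet> x \<le> 0\<close> with \<open>a\<close> in a finite set \<open>A\<close>. Adding up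
  suitable points of a face \<open>F\<close> yields \<open>f \<in> F\<close> such that \<open>a \<bullet> f \<le> - norm a\<close> for every \<open>a \<in> A\<close> that does
  not vanish on \<open>F\<close>. If \<open>x \<in> span F\<close> has distance \<open>r\<close> from a point of \<open>K\<close>, then \<open>x + r *\<^sub>R f\<close> satisfies all the
  inequalities, hence lies in \<open>K \<inter> span F = F\<close>.\<close>

section \<open>Infimum distances and boundedness of linear maps\<close>

lemma le_mult_infdistI:
  assumes "S \<noteq> {}" "0 \<le> k" and le: "\<And>y. y \<in> S \<Longrightarrow> d \<le> k * dist x y"
  shows "d \<le> k * infdist x S"
\<comment> \<open>The main case divides by \<open>k\<close>; for \<open>k = 0\<close> any single
  point of \<open>S\<close> already gives \<open>d \<le> 0\<close>.\<close>
proof (cases "k = 0")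
  case True
  then show ?thesis using assms by auto
next
  case False
  with \<open>0 \<le> k\<close> have "0 < k" by simp
  have "d / k \<le> infdist x S"
    unfolding infdist_notempty[OF \<open>S \<noteq> {}\<close>]
    using \<open>S \<noteq> {}\<close> \<open>0 < k\<close> le
    by (intro cINF_greatest) (auto simp: pos_divide_le_eq mult.commute)
  then show ?thesis using \<open>0 < k\<close> by (simp add: pos_divide_le_eq mult.commute)
qed

text \<open>The residual \<open>?z\<close> is orthogonal to all of \<open>C\<close> yet lies in
  \<open>span C\<close>, so it is orthogonal to itself. A zero vector in \<open>C\<close> is
  harmless, since its summand is zero.\<close>

lemma orthogonal_expansion:
  fixes C :: "'a::real_inner set"
  assumes "finite C" "pairwise orthogonal C" "x \<in> span C"
  shows "(\<Sum>c\<in>C. (x \<bullet> c / (c \<bullet> c)) *\<^sub>R c) = x"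
proof -
  let ?z = "x - (\<Sum>c\<in>C. (x \<bullet> c / (c \<bullet> c)) *\<^sub>R c)"
  have "orthogonal ?z c" if "c \<in> C" for c
  proof -
    have "(\<Sum>b\<in>C. (x \<bullet> b / (b \<bullet> b)) *\<^sub>R b) \<bullet> c = (\<Sum>b\<in>C. if b = c then x \<bullet> c else 0)"
      unfolding inner_sum_left
      using assms(2) that
      by (intro sum.cong) (auto simp: pairwise_def orthogonal_def)
    also have "\<dots> = x \<bullet> c"
      using assms(1) that by simp
    finally show ?thesis
      by (simp add: orthogonal_def inner_diff_left)
  qed
  moreover have "?z \<in> span C"
    by (intro span_diff[OF assms(3)] span_sum span_scale span_base)
  ultimately have "orthogonal ?z ?z"
    using orthogonal_to_span by blast
  then show ?thesis by (simp add: orthogonal_self)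
qed

text \<open>Finite dimension is given by a finite spanning set, not by the type. Expanding in an
  orthogonal spanning set writes \<open>f\<close> as a finite sum of bounded rank-one maps.\<close>

lemma bounded_linear_finite_span:
  fixes f :: "'a::real_inner \<Rightarrow> 'b::real_normed_vector" and B :: "'a set"
  assumes "finite B" "span B = UNIV" "linear f"
  shows "bounded_linear f"
proof -
  obtain C where C: "finite C" "span C = span B" "pairwise orthogonal C"
    using basis_orthogonal[OF \<open>finite B\<close>] by blast
  have f: "(\<Sum>c\<in>C. (x \<bullet> c / (c \<bullet> c)) *\<^sub>R f c) = f x" for x
  proof -
    have "(\<Sum>c\<in>C. (x \<bullet> c / (c \<bullet> c)) *\<^sub>R f c) = f (\<Sum>c\<in>C. (x \<bullet> c / (c \<bullet> c)) *\<^sub>R c)"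
      by (simp add: linear_sum[OF \<open>linear f\<close>] linear_scale[OF \<open>linear f\<close>])
    also have "\<dots> = f x"
      using orthogonal_expansion[OF C(1,3), of x] C(2) assms(2) by simp
    finally show ?thesis .
  qed
  have "bounded_linear (\<lambda>x. \<Sum>c\<in>C. (x \<bullet> c / (c \<bullet> c)) *\<^sub>R f c)"
    by (intro bounded_linear_sum bounded_linear_scaleR_const
        bounded_linear_divide[THEN bounded_linear_compose] bounded_linear_inner_left)
  then show ?thesis unfolding f .
qed

section \<open>Projectionally exposed cones\<close>

lemma infdist_projected_face_le:
  fixes K :: "'a::real_inner set"
  assumes "bounded_linear P" "linear_projection P" "P ` K = F" "K \<noteq> {}" "x \<in> span F"
  shows "infdist x F \<le> onorm P * infdist x K"
proof (rule le_mult_infdistI)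
  have P: "linear P" "P (P z) = P z" for z
    using assms(2) by (auto simp: linear_projection_def fun_eq_iff)
  have "P z = z" if "z \<in> F" for z
    using that P(2) \<open>P ` K = F\<close> by auto
  then have Px: "P x = x"
    using linear_eq_on_span[OF P(1) linear_id, of F x] \<open>x \<in> span F\<close> by simp
  show "infdist x F \<le> onorm P * dist x y" if "y \<in> K" for y
  proof (rule infdist_le2)
    show "P y \<in> F" using that \<open>P ` K = F\<close> by blast
    show "dist x (P y) \<le> onorm P * dist x y"
      using onorm[OF \<open>bounded_linear P\<close>, of "x - y"]
      by (simp add: dist_norm linear_diff[OF P(1)] Px)
  qed
qed (use assms onorm_pos_le in auto)

lemma projectionally_exposed_imp_amenable:
  fixes K B :: "'a::real_inner set"
  assumes "finite B" "span B = UNIV"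
    and "closed K" "convex_cone K" "projectionally_exposed K"
  shows "amenable K"
  unfolding amenable_def
proof (intro conjI allI impI)
  fix F assume "cone_face F K"
  then obtain P where P: "linear_projection P" "P ` K = F"
    using assms(5) by (auto simp: projectionally_exposed_def)
  then have bl: "bounded_linear P"
    using bounded_linear_finite_span[OF assms(1,2)] by (auto simp: linear_projection_def)
  \<comment> \<open>Adding 1 keeps the constant positive: \<open>onorm P\<close> is 0 when
    \<open>P\<close> is the zero map.\<close>
  have "infdist x F \<le> (onorm P + 1) * infdist x K" if "x \<in> span F" for x
    using infdist_projected_face_le[OF bl P convex_cone_nonempty[OF assms(4)] that]
      infdist_nonneg[of x K] by (simp add: distrib_right)
  then show "\<exists>\<kappa>>0. \<forall>x\<in>span F. infdist x F \<le> \<kappa> * infdist x K"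
    using onorm_pos_le[OF bl] by (intro exI[of _ "onorm P + 1"]) auto
qed (use assms in auto)

section \<open>Faces and their spans\<close>

lemma span_convex_cone:
  assumes "convex_cone F"
  shows "span F = {x - y | x y. x \<in> F \<and> y \<in> F}" (is "_ = ?D")
proof
  have "subspace ?D"
  proof (rule subspaceI)
    show "0 \<in> ?D"
      using convex_cone_contains_0[OF assms] by force
  next
    fix u v assume "u \<in> ?D" "v \<in> ?D"
    then obtain a b c d where "u = a - b" "v = c - d" and F: "a \<in> F" "b \<in> F" "c \<in> F" "d \<in> F"
      by blast
    then have "u + v = (a + c) - (b + d)" by simp
    with F convex_cone_add[OF assms] show "u + v \<in> ?D" by blast
  next
    fix r u assume "u \<in> ?D"
    then obtain a b where u: "u = a - b" and F: "a \<in> F" "b \<in> F"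
      by blast
    show "r *\<^sub>R u \<in> ?D"
    proof (cases "0 \<le> r")
      case True
      have "r *\<^sub>R u = r *\<^sub>R a - r *\<^sub>R b" by (simp add: u scaleR_diff_right)
      with F True convex_cone_scaleR[OF assms] show ?thesis by blast
    next
      case False
      \<comment> \<open>Only nonnegative factors preserve \<open>F\<close>, so a negative one swaps
        the two points.\<close>
      have "r *\<^sub>R u = (- r) *\<^sub>R b - (- r) *\<^sub>R a" by (simp add: u scaleR_diff_right)
      moreover have "0 \<le> - r" using False by simp
      ultimately show ?thesis using F convex_cone_scaleR[OF assms] by blast
    qed
  qed
  moreover have "F \<subseteq> ?D"
    using convex_cone_contains_0[OF assms] by force
  ultimately show "span F \<subseteq> ?D" by (rule span_minimal[rotated])
  show "?D \<subseteq> span F" by (auto intro: span_diff span_base)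
qed

text \<open>If \<open>x = a - b\<close> with \<open>a\<close>, \<open>b\<close> in \<open>F\<close>,
  then \<open>x + b = a\<close> is a sum of points of \<open>K\<close> lying in \<open>F\<close>,
  and the face property puts \<open>x\<close> in \<open>F\<close>.\<close>

lemma cone_face_eq_Int_span:
  assumes "cone_face F K"
  shows "F = K \<inter> span F"
proof -
  have "x \<in> F" if xK: "x \<in> K" and xF: "x \<in> span F" for x
  proof -
    obtain a b where "x = a - b" "a \<in> F" "b \<in> F"
      using xF assms span_convex_cone[of F] by (auto simp: cone_face_def)
    then have "x + b \<in> F" "b \<in> K"
      using assms by (auto simp: cone_face_def)
    with xK assms show ?thesis unfolding cone_face_def by blast
  qed
  then show ?thesis
    using assms span_superset[of F] by (auto simp: cone_face_def)
qed

section \<open>Polyhedral cones\<close>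

lemma polyhedron_convex_cone_homogeneous:
  assumes "polyhedron K" "convex_cone K"
  obtains A where "finite A" "K = {x. \<forall>a\<in>A. a \<bullet> x \<le> 0}"
proof -
  obtain \<H> where \<H>: "finite \<H>" "K = \<Inter> \<H>"
    and "\<forall>h\<in>\<H>. \<exists>a b. a \<noteq> 0 \<and> h = {x. a \<bullet> x \<le> b}"
    using assms(1) by (auto simp: polyhedron_def)
  then obtain a b where h: "\<And>h. h \<in> \<H> \<Longrightarrow> h = {x. a h \<bullet> x \<le> b h}"
    by metis
  have K: "x \<in> K \<longleftrightarrow> (\<forall>h\<in>\<H>. a h \<bullet> x \<le> b h)" for x
    using \<H>(2) h by blast
  have "x \<in> K \<longleftrightarrow> (\<forall>h\<in>\<H>. a h \<bullet> x \<le> 0)" for x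
  proof
    assume "x \<in> K"
    show "\<forall>h\<in>\<H>. a h \<bullet> x \<le> 0"
    proof (rule ballI, rule ccontr)
      fix h assume "h \<in> \<H>" and "\<not> a h \<bullet> x \<le> 0"
      then have pos: "0 < a h \<bullet> x" by simp
      have "0 \<le> b h"
        using K[of 0] \<open>h \<in> \<H>\<close> convex_cone_contains_0[OF assms(2)] by auto
      \<comment> \<open>Chosen so that \<open>a h \<bullet> (t *\<^sub>R x) = b h + 1\<close>, which
        violates the inequality of \<open>h\<close> although \<open>K\<close> is closed under
        scaling.\<close>
      define t where "t = (b h + 1) / (a h \<bullet> x)"
      have "t *\<^sub>R x \<in> K"
        using pos \<open>0 \<le> b h\<close> \<open>x \<in> K\<close> by (intro convex_cone_scaleR[OF assms(2)]) (auto simp: t_def)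
      then have "t * (a h \<bullet> x) \<le> b h"
        using K \<open>h \<in> \<H>\<close> by (metis inner_scaleR_right)
      then show False using pos by (simp add: t_def)
    qed
  next
    assume "\<forall>h\<in>\<H>. a h \<bullet> x \<le> 0"
    moreover have "0 \<le> b h" if "h \<in> \<H>" for h
      using K[of 0] that convex_cone_contains_0[OF assms(2)] by auto
    ultimately show "x \<in> K" using K by force
  qed
  then show ?thesis
    using \<H>(1) by (intro that[of "a ` \<H>"]) auto
qed

lemma convex_cone_sum:
  assumes "convex_cone F" "\<And>i. i \<in> I \<Longrightarrow> f i \<in> F"
  shows "sum f I \<in> F"
  using assms(2)
  by (induction I rule: infinite_finite_induct)
     (auto intro: convex_cone_add[OF assms(1)] convex_cone_contains_0[OF assms(1)])

text \<open>Each functional not vanishing on \<open>F\<close> is negative somewhere on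
  \<open>F\<close>, and scaling makes that value \<open>- norm a\<close>. Summing these points works
  because the other summands only lower the value.\<close>

lemma convex_cone_slater_point:
  assumes "finite A" "convex_cone F" and nonpos: "\<And>a x. a \<in> A \<Longrightarrow> x \<in> F \<Longrightarrow> a \<bullet> x \<le> 0"
  obtains f where "f \<in> F" "\<And>a. a \<in> A \<Longrightarrow> (\<forall>x\<in>F. a \<bullet> x = 0) \<or> a \<bullet> f \<le> - norm a"
proof -
  have "\<exists>g\<in>F. (\<forall>x\<in>F. a \<bullet> x = 0) \<or> a \<bullet> g \<le> - norm a" if "a \<in> A" for a
  proof (cases "\<forall>x\<in>F. a \<bullet> x = 0")
    case True
    then show ?thesis using convex_cone_contains_0[OF assms(2)] by blast
  next
    case False
    then obtain x where "x \<in> F" "a \<bullet> x < 0"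
      using nonpos[OF \<open>a \<in> A\<close>] by (meson order_le_less)
    then have "(norm a / - (a \<bullet> x)) *\<^sub>R x \<in> F"
      by (intro convex_cone_scaleR[OF assms(2)]) (auto simp: divide_nonneg_neg)
    moreover have "a \<bullet> ((norm a / - (a \<bullet> x)) *\<^sub>R x) = - norm a"
      using \<open>a \<bullet> x < 0\<close> by simp
    ultimately show ?thesis by (metis order_refl)
  qed
  then obtain g where g: "\<And>a. a \<in> A \<Longrightarrow> g a \<in> F"
    "\<And>a. a \<in> A \<Longrightarrow> (\<forall>x\<in>F. a \<bullet> x = 0) \<or> a \<bullet> g a \<le> - norm a"
    by metis
  have "a \<bullet> sum g A \<le> a \<bullet> g a" if "a \<in> A" for a
  proof -
    have "a \<bullet> sum g A = a \<bullet> g a + (\<Sum>b\<in>A - {a}. a \<bullet> g b)"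
      using assms(1) that by (simp add: sum.remove inner_add_right inner_sum_right)
    moreover have "(\<Sum>b\<in>A - {a}. a \<bullet> g b) \<le> 0"
      using g(1) that by (intro sum_nonpos nonpos) auto
    ultimately show ?thesis by simp
  qed
  then have "(\<forall>x\<in>F. a \<bullet> x = 0) \<or> a \<bullet> sum g A \<le> - norm a" if "a \<in> A" for a
    using g(2) that order_trans by blast
  moreover have "sum g A \<in> F"
    using convex_cone_sum[OF assms(2)] g(1) by blast
  ultimately show ?thesis using that by blast
qed

lemma polyhedron_imp_amenable:
  assumes "closed K" "convex_cone K" "polyhedron K"
  shows "amenable K"
  unfolding amenable_def
proof (intro conjI allI impI)
  fix F assume face: "cone_face F K"
  obtain A where A: "finite A" "K = {x. \<forall>a\<in>A. a \<bullet> x \<le> 0}"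
    using polyhedron_convex_cone_homogeneous[OF assms(3,2)] .
  have "convex_cone F" "F \<subseteq> K"
    using face by (auto simp: cone_face_def)
  then obtain f where f: "f \<in> F"
    and slater: "\<And>a. a \<in> A \<Longrightarrow> (\<forall>x\<in>F. a \<bullet> x = 0) \<or> a \<bullet> f \<le> - norm a"
    using convex_cone_slater_point[OF A(1), of F] A(2) by blast
  have "infdist x F \<le> (norm f + 1) * infdist x K" if x: "x \<in> span F" for x
  proof (rule le_mult_infdistI)
    fix y assume "y \<in> K"
    define z where "z = x + dist x y *\<^sub>R f"
    have "a \<bullet> z \<le> 0" if "a \<in> A" for a
      using slater[OF that]
    \<comment> \<open>Functionals vanishing on \<open>F\<close> vanish on \<open>span F\<close>,
      hence at \<open>z\<close>. For the others, Cauchy-Schwarz bounds the violation at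
      \<open>x\<close> by \<open>norm a * dist x y\<close>, which the shift along \<open>f\<close>
      cancels.\<close>
    proof
      assume *: "\<forall>u\<in>F. a \<bullet> u = 0"
      have "a \<bullet> u = 0" if "u \<in> span F" for u
        using * orthogonal_to_span[OF that, of a] by (auto simp: orthogonal_def)
      moreover have "z \<in> span F"
        using x f by (auto simp: z_def intro: span_add span_scale span_base)
      ultimately show ?thesis by simp
    next
      assume af: "a \<bullet> f \<le> - norm a"
      have "a \<bullet> x = a \<bullet> y + a \<bullet> (x - y)"
        by (simp add: inner_diff_right)
      also have "\<dots> \<le> norm a * dist x y"
        using \<open>y \<in> K\<close> A(2) that norm_cauchy_schwarz[of a "x - y"] by (force simp: dist_norm)
      finally show ?thesis
        using mult_left_mono[OF af zero_le_dist[of x y]]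
        by (simp add: z_def inner_add_right algebra_simps)
    qed
    then have "z \<in> K" using A(2) by simp
    moreover have "z \<in> span F"
      using x f by (auto simp: z_def intro: span_add span_scale span_base)
    ultimately have "z \<in> F"
      using cone_face_eq_Int_span[OF face] by blast
    \<comment> \<open>The shift has length \<open>dist x y * norm f\<close>; the extra 1 keeps the
      constant positive even for \<open>f = 0\<close>.\<close>
    moreover have "dist x z \<le> (norm f + 1) * dist x y"
      by (simp add: z_def dist_norm algebra_simps)
    ultimately show "infdist x F \<le> (norm f + 1) * dist x y"
      by (rule infdist_le2)
  qed (use convex_cone_nonempty[OF assms(2)] in auto)
  then show "\<exists>\<kappa>>0. \<forall>x\<in>span F. infdist x F \<le> \<kappa> * infdist x K"
    by (intro exI[of _ "norm f + 1"]) (auto intro: add_nonneg_pos)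
qed (use assms in auto)

section \<open>Strictly convex cones\<close>

text \<open>Dividing a point of \<open>K\<close> by \<open>t\<close> stays in \<open>K\<close>, so
  each distance from \<open>t *\<^sub>R x\<close> to \<open>K\<close> is \<open>t\<close> times one
  from \<open>x\<close>.\<close>

lemma infdist_scaleR_cone_ge:
  fixes K :: "'a::real_normed_vector set"
  assumes "convex_cone K" "0 < t"
  shows "t * infdist x K \<le> infdist (t *\<^sub>R x) K"
proof -
  have "t * infdist x K \<le> 1 * infdist (t *\<^sub>R x) K"
  proof (rule le_mult_infdistI)
    fix y assume "y \<in> K"
    then have "(1 / t) *\<^sub>R y \<in> K"
      using assms by (intro convex_cone_scaleR) auto
    then have "t * infdist x K \<le> t * dist x ((1 / t) *\<^sub>R y)"
      using \<open>0 < t\<close> by (intro mult_left_mono infdist_le) auto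
    also have "\<dots> = norm (t *\<^sub>R (x - (1 / t) *\<^sub>R y))"
      using \<open>0 < t\<close> by (simp add: dist_norm)
    also have "\<dots> = dist (t *\<^sub>R x) y"
      using \<open>0 < t\<close> by (simp add: dist_norm scaleR_diff_right)
    finally show "t * infdist x K \<le> 1 * dist (t *\<^sub>R x) y" by simp
  qed (use convex_cone_nonempty[OF assms(1)] in auto)
  then show ?thesis by simp
qed

lemma infdist_ray_le:
  fixes K :: "'a::real_inner set"
  assumes "closed K" "convex_cone K" "pointed_cone K" "convex_cone F" "F \<subseteq> K" "dim F = 1"
  shows "\<exists>\<kappa>>0. \<forall>x\<in>span F. infdist x F \<le> \<kappa> * infdist x K"
proof -
  obtain B where B: "B \<subseteq> F" "independent B" "F \<subseteq> span B" "card B = dim F"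
    using basis_exists by blast
  then obtain f where "B = {f}"
    using assms(6) card_1_singletonE by metis
  then have f: "f \<in> F" "f \<noteq> 0" "F \<subseteq> span {f}"
    using B by auto
  have span: "span F = range (\<lambda>t. t *\<^sub>R f)"
    using span_minimal[OF f(3) subspace_span] span_mono[of "{f}" F] f(1)
    by (auto simp: span_singleton)
  have "- f \<notin> K"
  proof
    assume "- f \<in> K"
    then have "f \<in> K \<inter> uminus ` K"
      using f(1) assms(5) by (auto intro: image_eqI[of _ _ "- f"])
    with f(2) assms(3) show False by (simp add: pointed_cone_def)
  qed
  then have d: "0 < infdist (- f) K"
    using assms(1) convex_cone_nonempty[OF assms(2)] by (intro infdist_pos_not_in_closed)
  \<comment> \<open>This compares the distances of \<open>- f\<close> to the origin and to
    \<open>K\<close>; by homogeneity the ratio serves all negative multiples of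
    \<open>f\<close>.\<close>
  define \<kappa> where "\<kappa> = norm f / infdist (- f) K"
  have "\<kappa> > 0" using f d by (simp add: \<kappa>_def)
  moreover have "infdist x F \<le> \<kappa> * infdist x K" if "x \<in> span F" for x
  proof -
    obtain t where x: "x = t *\<^sub>R f" using \<open>x \<in> span F\<close> span by blast
    show ?thesis
    proof (cases "0 \<le> t")
      case True
      then have "x \<in> F" using x f(1) convex_cone_scaleR[OF assms(4)] by blast
      then show ?thesis using \<open>\<kappa> > 0\<close> by (simp add: infdist_nonneg)
    next
      case False
      have "infdist x F \<le> - t * norm f"
        using infdist_le[OF convex_cone_contains_0[OF assms(4)], of x] False by (simp add: x)
      also have "\<dots> = \<kappa> * (- t * infdist (- f) K)"
        using d by (simp add: \<kappa>_def)
      also have "\<dots> \<le> \<kappa> * infdist x K"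
        using infdist_scaleR_cone_ge[OF assms(2), of "- t" "- f"] False \<open>\<kappa> > 0\<close>
        by (intro mult_left_mono) (auto simp: x)
      finally show ?thesis .
    qed
  qed
  ultimately show ?thesis by blast
qed

lemma strictly_convex_cone_imp_amenable:
  fixes K :: "'a::real_inner set"
  assumes "closed K" "convex_cone K" "strictly_convex_cone K"
  shows "amenable K"
  unfolding amenable_def
proof (intro conjI allI impI)
  fix F assume face: "cone_face F K"
  then consider "F = K" | "F = {0}" | "dim F = 1"
    using assms(3) by (auto simp: strictly_convex_cone_def)
  then show "\<exists>\<kappa>>0. \<forall>x\<in>span F. infdist x F \<le> \<kappa> * infdist x K"
  proof cases
    case 1
    then show ?thesis by (intro exI[of _ 1]) auto
  next
    case 2
    then show ?thesis by (intro exI[of _ 1]) (auto simp: infdist_nonneg)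
  next
    case 3
    then show ?thesis
      using infdist_ray_le[OF assms(1,2)] assms(3) face
      by (auto simp: strictly_convex_cone_def cone_face_def)
  qed
qed (use assms in auto)

theorem proposition9:
  fixes K :: "'a::real_inner set"
  assumes finite_dim: "\<exists>B::'a set. finite B \<and> span B = UNIV"
    and "closed K" and "convex_cone K" and "pointed_cone K"
  shows "((projectionally_exposed K \<longrightarrow> amenable K) \<and>
          (\<forall>F P. cone_face F K \<and> linear_projection P \<and> P ` K = F \<longrightarrow>
             (\<forall>x\<in>span F. infdist x F \<le> onorm P * infdist x K))) \<and>
         (polyhedron K \<longrightarrow> amenable K) \<and>
         (strictly_convex_cone K \<longrightarrow> amenable K)"
proof -
  obtain B :: "'a set" where B: "finite B" "span B = UNIV"
    using finite_dim by blast
  \<comment> \<open>Finite dimension makes \<open>P\<close> bounded, so \<open>onorm P\<close> is a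
    genuine operator norm.\<close>
  have "infdist x F \<le> onorm P * infdist x K"
    if "linear_projection P" "P ` K = F" "x \<in> span F" for F P x
    using that convex_cone_nonempty[OF assms(3)] bounded_linear_finite_span[OF B, of P]
    by (intro infdist_projected_face_le) (auto simp: linear_projection_def)
  then show ?thesis
    using projectionally_exposed_imp_amenable[OF B assms(2,3)]
      polyhedron_imp_amenable[OF assms(2,3)] strictly_convex_cone_imp_amenable[OF assms(2,3)]
    by blast
qed

end
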